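(* Let $b_1,b_2\ge 2$, $s_1,s_2\ge 1$ and $r_1,r_2$ be integers with $\gcd(r_1,s_1)=\gcd(r_2,s_2)=1$, let $f(x)=\frac{1}{b_1}x+\frac{r_1}{s_1}$, $g(x)=\frac{1}{b_2}x+\frac{r_2}{s_2}$, and assume $\frac{b_1r_1}{(b_1-1)s_1}\neq \frac{b_2r_2}{(b_2-1)s_2}$. Let $C$ be the attractor of $\{f,g\}$, $m\ge2$ an integer and $K=C^m$. Then the set $Di_m^{(K)}\setminus Sing_m$ contains uncountably many intrinsic Liouville vectors of $K$. In particular $\mathbf{FS}_m^{(K)}:=Di_m^{(K)}\setminus(Sing_m\cup Bad_m^{(K)})\neq\emptyset$, and consequently also $\mathbf{FS}_m^{(K)\ast}:=Di_m^{(K)}\setminus(Sing_m^{(K)}\cup Bad_m^{(K)})\neq\emptyset$.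
   Context: The attractor $C$ of $\{f,g\}$ is the unique nonempty compact set with $C=f(C)\cup g(C)$. For $\boldsymbol{\xi}\in\mathbb{R}^m$, $\Vert\boldsymbol{\xi}\Vert$ is the maximum-norm distance to the nearest integer vector. $\boldsymbol{\xi}$ is singular ($\boldsymbol{\xi}\in Sing_m$) if for every $c>0$ and all $Q\ge Q_0(c)$ there is an integer $1\le q\le Q$ with $\Vert q\boldsymbol{\xi}\Vert<cQ^{-1/m}$. Intrinsic notions with respect to $K$ (maximum norm $|\cdot|$ on $\mathbb{R}^m$ below): $\boldsymbol{\xi}\in Di_m^{(K)}$ if there is $c\in(0,1)$ such that for all sufficiently large $Q$ there exist integers $1\le q\le Q$ and $p_1,\dots,p_m$ with $(p_1/q,\dots,p_m/q)\in K$ and $|\boldsymbol{\xi}-(p_1/q,\dots,p_m/q)|<cQ^{-1/m}q^{-1}$. $\boldsymbol{\xi}\in Sing_m^{(K)}$ if for every $c>0$ the same holds for all $Q\ge Q_0(c)$. $\boldsymbol{\xi}\in Bad_m^{(K)}$ if there is $\kappa>0$ (depending on $\boldsymbol{\xi}$) with $\max_i|p_i/q-\xi_i|\ge\kappa q^{-1-1/m}$ whenever $q\ge1$, $p_i$ are integers and $(p_1/q,\dots,p_m/q)\in K$. A vector $\boldsymbol{\xi}\in\mathbb{R}^m\setminus\mathbb{Q}^m$ is an intrinsic Liouville vector of $K$ if for arbitrarily large $t>0$ there are integers $q\ge1$, $p_1,\dots,p_m$ with $(p_1/q,\dots,p_m/q)\in K$ and $\max_i|q\xi_i-p_i|\le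 q^{-t}$. *)

theory Defs
  imports "HOL-Analysis.Analysis"
begin

definition is_attractor :: "(real \<Rightarrow> real) \<Rightarrow> (real \<Rightarrow> real) \<Rightarrow> real set \<Rightarrow> bool" where
  "is_attractor f g C \<longleftrightarrow> compact C \<and> C \<noteq> {} \<and> C = f ` C \<union> g ` C"

definition cart_power :: "real set \<Rightarrow> (real ^ 'm) set" where
  "cart_power C = {x. \<forall>i. x $ i \<in> C}"

definition int_vec :: "int ^ 'm \<Rightarrow> real ^ 'm" where
  "int_vec p = (\<chi> i. of_int (p $ i))"

definition rat_vec :: "int ^ 'm \<Rightarrow> int \<Rightarrow> real ^ 'm" where
  "rat_vec p q = (\<chi> i. of_int (p $ i) / of_int q)"

(* infnorm is the maximum norm on real^'m (the norm of the type class is the Euclidean one). *)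
definition dist_int :: "real ^ 'm \<Rightarrow> real" where
  "dist_int \<xi> = (INF p :: int ^ 'm. infnorm (\<xi> - int_vec p))"

definition Sing :: "(real ^ 'm) set" where
  "Sing = {\<xi>. \<forall>c>0. \<exists>Q0. \<forall>Q\<ge>Q0. \<exists>q::int. 1 \<le> q \<and> of_int q \<le> Q \<and>
     dist_int (of_int q *\<^sub>R \<xi>) < c * Q powr (- 1 / real CARD('m))}"

definition intrinsic_dirichlet :: "(real ^ 'm) set \<Rightarrow> real ^ 'm \<Rightarrow> real \<Rightarrow> bool" where
  "intrinsic_dirichlet K \<xi> c \<longleftrightarrow>
     (\<exists>Q0. \<forall>Q\<ge>Q0. \<exists>(q::int) (p::int ^ 'm). 1 \<le> q \<and> of_int q \<le> Q \<and> rat_vec p q \<in> K \<and>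
        infnorm (\<xi> - rat_vec p q) < c * Q powr (- 1 / real CARD('m)) / of_int q)"

definition Di_on :: "(real ^ 'm) set \<Rightarrow> (real ^ 'm) set" where
  "Di_on K = {\<xi>. \<exists>c. 0 < c \<and> c < 1 \<and> intrinsic_dirichlet K \<xi> c}"

definition Sing_on :: "(real ^ 'm) set \<Rightarrow> (real ^ 'm) set" where
  "Sing_on K = {\<xi>. \<forall>c>0. intrinsic_dirichlet K \<xi> c}"

definition Bad_on :: "(real ^ 'm) set \<Rightarrow> (real ^ 'm) set" where
  "Bad_on K = {\<xi>. \<exists>\<kappa>>0. \<forall>(q::int) (p::int ^ 'm). 1 \<le> q \<longrightarrow> rat_vec p q \<in> K \<longrightarrow>
     infnorm (rat_vec p q - \<xi>) \<ge> \<kappa> * of_int q powr (- 1 - 1 / real CARD('m))}"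

(* Denominators are required to be at least 2. With q = 1 the bound q powr (-t) equals 1 for
   every t, so a single integer point of K within distance 1 of \<xi> would make the condition
   vacuous. The version with 1 \<le> q follows, see intrinsic_liouville_denom_ge_1. *)
definition intrinsic_liouville :: "(real ^ 'm) set \<Rightarrow> real ^ 'm \<Rightarrow> bool" where
  "intrinsic_liouville K \<xi> \<longleftrightarrow>
     \<not> (\<forall>i. \<xi> $ i \<in> \<rat>) \<and>
     (\<forall>T>0. \<exists>t>T. \<exists>(q::int) (p::int ^ 'm). 2 \<le> q \<and> rat_vec p q \<in> K \<and>
        infnorm (of_int q *\<^sub>R \<xi> - int_vec p) \<le> of_int q powr (- t))"

lemma intrinsic_liouville_denom_ge_1:
  assumes "intrinsic_liouville K \<xi>"
  shows "\<not> (\<forall>i. \<xi> $ i \<in> \<rat>) \<and>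
     (\<forall>T>0. \<exists>t>T. \<exists>(q::int) p. 1 \<le> q \<and> rat_vec p q \<in> K \<and>
        infnorm (of_int q *\<^sub>R \<xi> - int_vec p) \<le> of_int q powr (- t))"
proof -
  have "1 \<le> q" if "2 \<le> q" for q :: int
    using that by simp
  with assms show ?thesis
    unfolding intrinsic_liouville_def by meson
qed

definition FS_on :: "(real ^ 'm) set \<Rightarrow> (real ^ 'm) set" where
  "FS_on K = Di_on K - (Sing \<union> Bad_on K)"

definition FS_star_on :: "(real ^ 'm) set \<Rightarrow> (real ^ 'm) set" where
  "FS_star_on K = Di_on K - (Sing_on K \<union> Bad_on K)"

end

theory Submission
  imports Defs
begin

text \<open>
  The maps \<open>f \<circ> g\<close> and \<open>g \<circ> f\<close> have the same ratio \<open>1 / b\<close>, where \<open>b = b1 * b2\<close>, and distinct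
  translation parts. Hence \<open>C\<close> contains all points \<open>X + D * (\<Sum>n\<in>T. b ^ (-n))\<close> with \<open>T\<close> an arbitrary set
  of naturals and \<open>X\<close>, \<open>D \<noteq> 0\<close> fixed rationals, and truncating \<open>T\<close> after \<open>t\<close> gives a rational
  point of \<open>C\<close> with denominator dividing \<open>S * b ^ t\<close>. In coordinate \<open>j \<in> {1..m}\<close> take the digit set
  \<open>{j * A k - L | k}\<close> for a sequence \<open>A\<close> growing faster than geometrically and a large constant \<open>L\<close>.
  Consecutive digit positions \<open>t < t'\<close> of all coordinates together satisfy
  \<open>m * t + L \<le> (m - 1) * t'\<close>, so truncations give the improved Dirichlet property; truncating at the end of
  a block \<open>k\<close> gives Liouville approximations. Conversely, a multiplier \<open>q\<close> that brings all
  coordinates within about \<open>b ^ (- A k)\<close> of the integers is successively divisible by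
  \<open>b ^ (j * A k - L)\<close> for \<open>j = 1, \<dots>, m\<close>, so \<open>q \<ge> b ^ (m * A k - L)\<close>: the point is not singular. Perturbing
  each \<open>A k\<close> by one bit gives uncountably many points.
\<close>

section \<open>Digit sums in base b and their truncations\<close>

definition digit_sum :: "nat \<Rightarrow> nat set \<Rightarrow> real" where
  "digit_sum b T = (\<Sum>n. of_bool (n \<in> T) / real b ^ n)"

lemma summable_digits:
  assumes "b \<ge> 2"
  shows "summable (\<lambda>n. of_bool (n \<in> T) / real b ^ n)"
proof (rule summable_comparison_test')
  show "summable (\<lambda>n. (1 / real b) ^ n)"
    using assms by (intro summable_geometric) auto
  show "norm (of_bool (n \<in> T) / real b ^ n) \<le> (1 / real b) ^ n" if "n \<ge> 0" for n
    by (simp add: power_divide)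
qed

lemma digit_sum_finite:
  "finite T \<Longrightarrow> digit_sum b T = (\<Sum>n\<in>T. 1 / real b ^ n)"
  unfolding digit_sum_def by (subst suminf_finite[of T]) auto

lemma digit_sum_nonneg:
  assumes "b \<ge> 2"
  shows "0 \<le> digit_sum b T"
  unfolding digit_sum_def by (intro suminf_nonneg summable_digits assms) auto

lemma digit_sum_split:
  assumes "b \<ge> 2"
  shows "digit_sum b T = digit_sum b (T \<inter> U) + digit_sum b (T - U)"
  unfolding digit_sum_def
  by (subst suminf_add[OF summable_digits[OF assms] summable_digits[OF assms]])
     (intro suminf_cong; auto)

lemma digit_sum_tail:
  assumes b: "b \<ge> 2" and T: "T \<subseteq> {N..}"
  shows "digit_sum b T \<le> 2 / real b ^ N"
proof -
  let ?f = "\<lambda>n. of_bool (n \<in> T) / real b ^ n"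
  have lt: "norm (1 / real b) < 1" using b by auto
  have "digit_sum b T = (\<Sum>n. ?f (n + N)) + (\<Sum>n<N. ?f n)"
    unfolding digit_sum_def by (rule suminf_split_initial_segment[OF summable_digits[OF b]])
  also have "(\<Sum>n<N. ?f n) = 0"
    using T by (intro sum.neutral) auto
  also have "(\<Sum>n. ?f (n + N)) \<le> (\<Sum>n. 1 / real b ^ N * (1 / real b) ^ n)"
    by (intro suminf_le summable_ignore_initial_segment summable_digits b summable_mult
        summable_geometric lt)
       (auto simp: power_add power_divide field_simps)
  also have "\<dots> = 1 / real b ^ N * (1 / (1 - 1 / real b))"
    by (subst suminf_mult) (use lt in \<open>auto simp: suminf_geometric\<close>)
  also have "\<dots> \<le> 1 / real b ^ N * 2"
    using b by (intro mult_left_mono) (auto simp: field_simps)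
  finally show ?thesis by simp
qed

text \<open>The first digit after the cut at \<open>t\<close> stands at \<open>t'\<close> or later,
  so a long run of zeros makes the truncation an unusually good approximation.\<close>

lemma digit_sum_gap:
  assumes b: "b \<ge> 2" and gap: "T \<inter> {t<..<t'} = {}"
  shows "\<bar>digit_sum b T - digit_sum b (T \<inter> {..t})\<bar> \<le> 2 / real b ^ t'"
proof -
  have "T - {..t} \<subseteq> {t'..}" using gap by force
  then show ?thesis
    using digit_sum_split[OF b, of T "{..t}"] digit_sum_tail[OF b] digit_sum_nonneg[OF b, of "T - {..t}"]
    by simp
qed

text \<open>In the numerator, a sum of powers b^(n - t), only the term t = n is not a multiple of b.
  The coprimality later moves divisibility from \<open>q * P\<close> to \<open>q\<close>.\<close>

lemma digit_sum_integral:
  assumes "b \<ge> 2" "T \<subseteq> {..n}"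
  obtains P :: int where "digit_sum b T = of_int P / real b ^ n"
    "n \<in> T \<Longrightarrow> coprime P (int b)"
proof -
  have fin: "finite T" using assms(2) finite_subset by blast
  define P where "P = (\<Sum>t\<in>T. int b ^ (n - t))"
  have "digit_sum b T = (\<Sum>t\<in>T. real b ^ (n - t) / real b ^ n)"
    unfolding digit_sum_finite[OF fin] using assms
    by (intro sum.cong refl) (auto simp: power_diff)
  then have eq: "digit_sum b T = of_int P / real b ^ n"
    by (simp add: P_def sum_divide_distrib)
  have "coprime P (int b)" if "n \<in> T"
  proof -
    have "P = 1 + (\<Sum>t\<in>T - {n}. int b ^ (n - t))"
      unfolding P_def using fin that by (subst sum.remove[of _ n]) auto
    moreover have "int b dvd (\<Sum>t\<in>T - {n}. int b ^ (n - t))"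
      using assms by (intro dvd_sum dvd_power) force
    ultimately obtain k where "P = 1 + int b * k" by (auto elim!: dvdE)
    then show ?thesis by (auto intro!: coprimeI simp: dvd_add_left_iff)
  qed
  with eq show ?thesis using that by blast
qed

text \<open>All digits after \<open>n\<close> are worth at most 2/b^(n+1), which is below 1/b^n once
  b >= 3. For b = 2 a full tail of ones would make up for the digit at \<open>n\<close>.\<close>

lemma digit_sum_less_of_first_difference:
  assumes b: "b \<ge> 3" and n: "n \<in> T" "n \<notin> T'" and same: "T \<inter> {..<n} = T' \<inter> {..<n}"
  shows "digit_sum b T' < digit_sum b T"
proof -
  have b2: "b \<ge> 2" using b by simp
  have "T' - {..<n} \<subseteq> {Suc n..}" using n by (auto simp: Suc_le_eq) (metis le_neq_implies_less not_le)
  then have "digit_sum b (T' - {..<n}) \<le> 2 / real b ^ Suc n"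
    by (rule digit_sum_tail[OF b2])
  also have "\<dots> < 1 / real b ^ n" using b by (simp add: field_simps)
  also have "\<dots> = digit_sum b ((T - {..<n}) \<inter> {n})"
  proof -
    have "(T - {..<n}) \<inter> {n} = {n}" using n by auto
    then show ?thesis by (simp add: digit_sum_finite)
  qed
  also have "\<dots> \<le> digit_sum b (T - {..<n})"
    using digit_sum_split[OF b2, of "T - {..<n}" "{n}"] digit_sum_nonneg[OF b2, of "T - {..<n} - {n}"]
    by simp
  finally show ?thesis
    using digit_sum_split[OF b2, of T "{..<n}"] digit_sum_split[OF b2, of T' "{..<n}"] same by simp
qed

lemma inj_digit_sum:
  assumes b: "b \<ge> 3"
  shows "inj (digit_sum b)"
proof (rule injI, rule ccontr)
  fix T T' assume eq: "digit_sum b T = digit_sum b T'" and "T \<noteq> T'"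
  define n where "n = (LEAST n. (n \<in> T) \<noteq> (n \<in> T'))"
  have "\<exists>n. (n \<in> T) \<noteq> (n \<in> T')" using \<open>T \<noteq> T'\<close> by auto
  then have n: "(n \<in> T) \<noteq> (n \<in> T')" unfolding n_def by (rule LeastI_ex)
  have "(k \<in> T) = (k \<in> T')" if "k < n" for k
    using not_less_Least[OF that[unfolded n_def]] by blast
  then have "T \<inter> {..<n} = T' \<inter> {..<n}" by blast
  with n digit_sum_less_of_first_difference[OF b, of n T T'] digit_sum_less_of_first_difference[OF b, of n T' T] eq
  show False by auto
qed

text \<open>A seed in \<open>C\<close> is moved by the two contractions as the digits of
  \<open>T\<close> dictate, and closedness gives the limit. The first summand is the limit for empty
  \<open>T\<close>; each element of \<open>T\<close> replaces one \<open>\<tau>0\<close> by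
  \<open>\<tau>1\<close>.\<close>

lemma digit_sum_in_attractor:
  fixes C :: "real set"
  assumes "closed C" "C \<noteq> {}" and b: "b \<ge> 2"
    and 0: "\<And>x. x \<in> C \<Longrightarrow> x / real b + \<tau>0 \<in> C"
    and 1: "\<And>x. x \<in> C \<Longrightarrow> x / real b + \<tau>1 \<in> C"
  shows "\<tau>0 * (real b / (real b - 1)) + (\<tau>1 - \<tau>0) * digit_sum b T \<in> C"
proof -
  obtain c where c: "c \<in> C" using assms by blast
  define d where "d T n = (if n \<in> T then \<tau>1 else \<tau>0)" for n :: nat and T
  have partial: "(\<Sum>n<N. d T n / real b ^ n) + c / real b ^ N \<in> C" for N T
  proof (induction N arbitrary: T)
    case (Suc N)
    \<comment> \<open>The map applied last contributes the digit at 0 and shifts the others by one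
      place; hence the induction for all \<open>T\<close>.\<close>
    let ?y = "(\<Sum>n<N. d {n. Suc n \<in> T} n / real b ^ n) + c / real b ^ N"
    have "(\<Sum>n<Suc N. d T n / real b ^ n) + c / real b ^ Suc N = ?y / real b + d T 0"
      by (subst sum.lessThan_Suc_shift) (simp add: d_def add_divide_distrib sum_divide_distrib mult.commute)
    moreover have "?y / real b + d T 0 \<in> C"
      using Suc.IH[of "{n. Suc n \<in> T}"] 0 1 by (auto simp: d_def)
    ultimately show ?case by metis
  qed (use c in simp)
  have lt: "norm (1 / real b) < 1" using b by auto
  have "(\<lambda>n. (1 / real b) ^ n) sums (1 / (1 - 1 / real b))"
    using lt by (rule geometric_sums)
  moreover have "1 / (1 - 1 / real b) = real b / (real b - 1)" using b by (simp add: field_simps)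
  ultimately have g: "(\<lambda>n. (1 / real b) ^ n) sums (real b / (real b - 1))" by simp
  have "(\<lambda>n. of_bool (n \<in> T) / real b ^ n) sums digit_sum b T"
    unfolding digit_sum_def using summable_digits[OF b] by (rule summable_sums)
  from sums_add[OF sums_mult[OF g, of \<tau>0] sums_mult[OF this, of "\<tau>1 - \<tau>0"]]
  have "(\<lambda>n. \<tau>0 * (1 / real b) ^ n + (\<tau>1 - \<tau>0) * (of_bool (n \<in> T) / real b ^ n)) sums
    (\<tau>0 * (real b / (real b - 1)) + (\<tau>1 - \<tau>0) * digit_sum b T)" .
  moreover have "(\<lambda>n. \<tau>0 * (1 / real b) ^ n + (\<tau>1 - \<tau>0) * (of_bool (n \<in> T) / real b ^ n)) = (\<lambda>n. d T n / real b ^ n)"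
    by (auto simp: d_def fun_eq_iff power_divide diff_divide_distrib)
  ultimately have "(\<lambda>N. \<Sum>n<N. d T n / real b ^ n) \<longlonglongrightarrow>
      \<tau>0 * (real b / (real b - 1)) + (\<tau>1 - \<tau>0) * digit_sum b T"
    unfolding sums_def by metis
  moreover have "(\<lambda>N. c / real b ^ N) \<longlonglongrightarrow> 0"
    using tendsto_mult_right_zero[OF LIMSEQ_power_zero[OF lt], of c] by (simp add: power_divide)
  ultimately have "(\<lambda>N. (\<Sum>n<N. d T n / real b ^ n) + c / real b ^ N) \<longlonglongrightarrow>
      \<tau>0 * (real b / (real b - 1)) + (\<tau>1 - \<tau>0) * digit_sum b T"
    using tendsto_add by fastforce
  from closed_sequentially[OF assms(1) partial this] show ?thesis .
qed

section \<open>Lacunary digit sets and their interlacing\<close>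

text \<open>The factor 4 * m makes each block short compared with the gap behind it; the unbounded
  \<open>k\<close> makes the Liouville exponents unbounded. The shift \<open>L\<close> provides room
  for constant factors.\<close>

locale lacunary =
  fixes b m L :: nat and A :: "nat \<Rightarrow> nat"
  assumes b: "b \<ge> 4" and m: "m \<ge> 2" and L: "\<And>k. L < A k"
    and growth: "\<And>k. (k + 4 * m) * A k \<le> A (Suc k)"
begin

text \<open>By \<open>L < A k\<close> the subtraction is exact for j >= 1, while j = 0 gives 0, the
  base case of the induction in \<open>no_small_multiplier\<close>.\<close>

definition digit_pos :: "nat \<Rightarrow> nat \<Rightarrow> nat" where
  "digit_pos j k = j * A k - L"

definition digits :: "nat \<Rightarrow> nat set" where
  "digits j = range (digit_pos j)"

lemma growth_m: "4 * m * A k \<le> A (Suc k)"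
  using growth[of k] by (simp add: add_mult_distrib)

lemma m_le_next: "m * A k \<le> A (Suc k)"
  using growth_m[of k] by simp

lemma strict_mono_A: "strict_mono A"
proof (rule strict_mono_Suc_iff[THEN iffD2], rule allI)
  fix k
  have "0 < A k" using L[of k] by simp
  then have "1 * A k < 4 * m * A k" using m by (intro mult_strict_right_mono) auto
  with growth_m[of k] show "A k < A (Suc k)" by linarith
qed

lemma le_A: "k \<le> A k"
  using strict_mono_A by (rule strict_mono_imp_increasing)

lemma m_le_later: "k < k' \<Longrightarrow> m * A k \<le> A k'"
  using m_le_next[of k] strict_mono_A by (meson Suc_leI order_trans strict_mono_less_eq)

lemma digit_pos_mono: "j \<le> j' \<Longrightarrow> digit_pos j k \<le> digit_pos j' k"
  by (auto simp: digit_pos_def intro!: diff_le_mono mult_right_mono)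

lemma digit_pos_block: "k < k' \<Longrightarrow> j \<le> m \<Longrightarrow> 1 \<le> j' \<Longrightarrow> digit_pos j k \<le> digit_pos j' k'"
proof -
  assume *: "k < k'" "j \<le> m" "1 \<le> j'"
  have "j * A k \<le> m * A k" using * by simp
  also have "\<dots> \<le> 1 * A k'" using m_le_later * by simp
  also have "\<dots> \<le> j' * A k'" using * by (intro mult_right_mono) auto
  finally show ?thesis unfolding digit_pos_def by (rule diff_le_mono)
qed

text \<open>Since m * A k <= A (k + 1), the digit positions of all coordinates together are ordered
  first by block and then by coordinate. The right end of the interval is the successor of its left
  end in this order.\<close>

lemma no_digit_between:
  assumes j: "1 \<le> j" "j \<le> m" and i: "1 \<le> i" "i \<le> m"
  shows "digits i \<inter> {digit_pos j k<..<(if j < m then digit_pos (Suc j) k else digit_pos 1 (Suc k))} = {}"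
proof -
  let ?t' = "if j < m then digit_pos (Suc j) k else digit_pos 1 (Suc k)"
  have "digit_pos i l \<le> digit_pos j k \<or> ?t' \<le> digit_pos i l" for l
  proof (cases l k rule: linorder_cases)
    case less
    then show ?thesis using digit_pos_block[of l k i j] i j by simp
  next
    case equal
    then show ?thesis using digit_pos_mono[of i j k] digit_pos_mono[of "Suc j" i k] i j
      by (cases "i \<le> j") auto
  next
    case greater
    have "digit_pos (Suc j) k \<le> digit_pos i l" if "j < m"
      using digit_pos_block[of k l "Suc j" i] greater that i by simp
    moreover have "digit_pos 1 (Suc k) \<le> digit_pos i l"
    proof (cases "l = Suc k")
      case True
      then show ?thesis using digit_pos_mono i by simp
    next
      case False
      then show ?thesis using digit_pos_block[of "Suc k" l 1 i] greater i m by simp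
    qed
    ultimately show ?thesis by simp
  qed
  then have "digit_pos i l \<notin> {digit_pos j k<..<?t'}" for l
    unfolding greaterThanLessThan_iff by (meson leD)
  then show ?thesis unfolding digits_def by blast
qed

text \<open>The shift lowers the left side by m * L and the right side by (m - 1) * L, and the
  difference is the slack \<open>L\<close>. What remains is m * j <= (m - 1) * (j + 1), that is j <
  m, inside a block, and m * m <= (m - 1) * 4 * m between blocks.\<close>

lemma gap_ratio:
  assumes j: "1 \<le> j" "j \<le> m"
  shows "m * digit_pos j k + L \<le> (m - 1) * (if j < m then digit_pos (Suc j) k else digit_pos 1 (Suc k))"
proof -
  have L': "L \<le> i * A k" if "1 \<le> i" for i k
    using L[of k] that by (metis le_trans less_imp_le mult_le_mono1 nat_mult_1)
  have pos: "int (digit_pos i k) = int i * int (A k) - int L" if "1 \<le> i" for i k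
    using L'[OF that] by (simp add: digit_pos_def of_nat_diff)
  have "int m * int (digit_pos j k) + int L \<le> (int m - 1) * int (if j < m then digit_pos (Suc j) k else digit_pos 1 (Suc k))"
  proof (cases "j < m")
    case True
    have "int (Suc j) * int (A k) \<le> int m * int (A k)"
      using True by (intro mult_right_mono) auto
    then show ?thesis using True j by (simp add: pos algebra_simps)
  next
    case False
    with j have [simp]: "j = m" by simp
    have "int m * (int m * int (A k)) \<le> (int m - 1) * (4 * int m * int (A k))"
    proof -
      have "int m \<le> 4 * (int m - 1)" using m by simp
      then have "int m * (int m * int (A k)) \<le> 4 * (int m - 1) * (int m * int (A k))"
        by (intro mult_right_mono) auto
      then show ?thesis by (simp add: ac_simps)
    qed
    also have "\<dots> \<le> (int m - 1) * int (A (Suc k))"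
    proof -
      have "int (4 * m * A k) \<le> int (A (Suc k))"
        using growth_m[of k] by (simp only: of_nat_le_iff)
      then show ?thesis using m by (intro mult_left_mono) auto
    qed
    finally show ?thesis using m by (simp add: pos algebra_simps)
  qed
  then have "int (m * digit_pos j k + L) \<le> int ((m - 1) * (if j < m then digit_pos (Suc j) k else digit_pos 1 (Suc k)))"
    using m by (simp add: of_nat_diff)
  then show ?thesis by (simp only: of_nat_le_iff)
qed

text \<open>Two nested maxima locate \<open>N\<close>: the last block that has begun by
  \<open>N\<close>, then the last digit of this block not beyond \<open>N\<close>.\<close>

lemma gap_exists:
  assumes N: "A 0 \<le> N"
  obtains t t' where "t \<le> N" "N < t'" "m * t + L \<le> (m - 1) * t'"
    "\<And>i. 1 \<le> i \<Longrightarrow> i \<le> m \<Longrightarrow> digits i \<inter> {t<..<t'} = {}"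
proof -
  define k where "k = (GREATEST k. digit_pos 1 k \<le> N)"
  \<comment> \<open>Because k <= A k, only finitely many blocks begin by \<open>N\<close>, so the
    maximum exists.\<close>
  have bound: "k \<le> N + L" if "digit_pos 1 k \<le> N" for k
    using that le_A[of k] by (simp add: digit_pos_def)
  have k: "digit_pos 1 k \<le> N"
    unfolding k_def by (rule GreatestI_nat[of _ 0 "N + L"]) (use N bound in \<open>auto simp: digit_pos_def\<close>)
  have "k' \<le> k" if "digit_pos 1 k' \<le> N" for k'
    unfolding k_def using that bound by (intro Greatest_le_nat[of _ _ "N + L"]) auto
  from this[of "Suc k"] have k1: "N < digit_pos 1 (Suc k)" by (meson Suc_n_not_le_n not_le)
  define j where "j = (GREATEST j. j \<le> m \<and> digit_pos j k \<le> N)"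
  have j: "j \<le> m \<and> digit_pos j k \<le> N"
    unfolding j_def by (rule GreatestI_nat[of _ 1 m]) (use k m in auto)
  have jmax: "j' \<le> j" if "j' \<le> m \<and> digit_pos j' k \<le> N" for j'
    unfolding j_def using that by (intro Greatest_le_nat[of _ _ m]) auto
  have j1: "1 \<le> j" using jmax[of 1] k m by simp
  have "N < digit_pos (Suc j) k" if "j < m"
    using jmax[of "Suc j"] that by (meson Suc_leI Suc_n_not_le_n not_le)
  with k1 j j1 gap_ratio[of j k] no_digit_between[of j] show ?thesis
    by (intro that[of "digit_pos j k" "if j < m then digit_pos (Suc j) k else digit_pos 1 (Suc k)"]) auto
qed

lemma digits_gap_same:
  "digits i \<inter> {digit_pos i k<..<digit_pos i (Suc k)} = {}"
proof -
  have mono: "digit_pos i l \<le> digit_pos i l'" if "l \<le> l'" for l l'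
    using strict_mono_A that by (auto simp: digit_pos_def strict_mono_less_eq intro!: diff_le_mono mult_left_mono)
  have "digit_pos i l \<notin> {digit_pos i k<..<digit_pos i (Suc k)}" for l
    unfolding greaterThanLessThan_iff using mono[of l k] mono[of "Suc k" l] by (cases "l \<le> k") auto
  then show ?thesis unfolding digits_def by blast
qed

text \<open>This lets a multiplier below b^(digit_pos m k) disregard the later blocks: they
  contribute at most half of the tolerance 1/b^(A k).\<close>

lemma digit_tail_small:
  "2 * real b ^ digit_pos m k / real b ^ digit_pos 1 (Suc k) \<le> 1 / (2 * real b ^ A k)"
proof -
  have "Suc (m * A k + A k) \<le> 4 * m * A k"
  proof -
    have "A k \<le> m * A k" using m by (cases m) auto
    moreover have "1 \<le> A k" using L[of k] by simp
    ultimately show ?thesis unfolding mult.assoc by linarith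
  qed
  also have "\<dots> \<le> A (Suc k)" by (rule growth_m)
  finally have le: "Suc (m * A k + A k) \<le> A (Suc k)" .
  have "L \<le> m * A k" using L[of k] m by (metis le_trans less_imp_le mult_le_mono1 nat_mult_1 one_le_numeral)
  then have "digit_pos m k + A k + 1 \<le> digit_pos 1 (Suc k)"
    using le by (simp add: digit_pos_def)
  then have "real b ^ (digit_pos m k + A k + 1) \<le> real b ^ digit_pos 1 (Suc k)"
    using b by (intro power_increasing) auto
  \<comment> \<open>The assumption b >= 4 pays for the two factors 2 of the claim.\<close>
  moreover have "4 * real b ^ (digit_pos m k + A k) \<le> real b ^ (digit_pos m k + A k + 1)"
    using b by simp
  ultimately have "4 * (real b ^ digit_pos m k * real b ^ A k) \<le> real b ^ digit_pos 1 (Suc k)"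
    unfolding power_add by linarith
  then show ?thesis using b by (simp add: field_simps)
qed

text \<open>Induction on j raises the power of b dividing \<open>q\<close> from one digit of block
  \<open>k\<close> to the next. Truncated at the next digit, the digit sum is P/b^n, and q * P - W *
  b^n is divisible by b^n0 but smaller than b^n0 in absolute value, hence 0. As P is coprime to b,
  b^n divides \<open>q\<close>. For j = m this forces q = 0 by size.\<close>

lemma no_small_multiplier:
  fixes q :: int and W :: "nat \<Rightarrow> int"
  assumes q: "\<bar>q\<bar> < int b ^ digit_pos m k"
    and close: "\<And>j. 1 \<le> j \<Longrightarrow> j \<le> m \<Longrightarrow>
      \<bar>of_int q * digit_sum b (digits j) - of_int (W j)\<bar> < 1 / (2 * real b ^ A k)"
  shows "q = 0"
proof -
  have b2: "b \<ge> 2" using b by simp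
  have "int b ^ digit_pos j k dvd q" if "j \<le> m" for j
    using that
  proof (induction j)
    case 0
    then show ?case by (simp add: digit_pos_def)
  next
    case (Suc j)
    define n where "n = digit_pos (Suc j) k"
    define n0 where "n0 = digit_pos j k"
    \<comment> \<open>Only an inequality, because n0 = 0 and n = A k - L when j = 0.\<close>
    have n: "n \<le> n0 + A k" by (simp add: n_def n0_def digit_pos_def)
    have n_mono: "n0 \<le> n" by (simp add: n_def n0_def digit_pos_mono)
    let ?T = "digits (Suc j)"
    have "n \<in> ?T" by (simp add: n_def digits_def)
    then obtain P where P: "digit_sum b (?T \<inter> {..n}) = of_int P / real b ^ n" "coprime P (int b)"
      using digit_sum_integral[OF b2, of "?T \<inter> {..n}" n] by auto
    have "digit_pos 1 (Suc k) \<le> digit_pos (Suc j) (Suc k)" by (rule digit_pos_mono) simp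
    then have "?T \<inter> {n<..<digit_pos 1 (Suc k)} = {}"
      using digits_gap_same[of "Suc j" k] unfolding n_def by (auto simp: disjoint_iff)
    from digit_sum_gap[OF b2 this]
    have tail: "\<bar>digit_sum b ?T - of_int P / real b ^ n\<bar> \<le> 2 / real b ^ digit_pos 1 (Suc k)"
      by (simp add: P)
    have q': "\<bar>of_int q\<bar> \<le> real b ^ digit_pos m k"
      using q by (metis (mono_tags, lifting) less_imp_le of_int_abs of_int_le_iff of_int_of_nat_eq of_int_power)
    have "\<bar>of_int q * (digit_sum b ?T - of_int P / real b ^ n)\<bar>
        \<le> real b ^ digit_pos m k * (2 / real b ^ digit_pos 1 (Suc k))"
      unfolding abs_mult using q' tail by (intro mult_mono) auto
    also have "\<dots> \<le> 1 / (2 * real b ^ A k)" using digit_tail_small[of k] by (simp add: mult.commute)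
    finally have small: "\<bar>of_int q * (digit_sum b ?T - of_int P / real b ^ n)\<bar> \<le> 1 / (2 * real b ^ A k)" .
    \<comment> \<open>The tail and the hypothesis \<open>close\<close> each account for half of the
      tolerance.\<close>
    have "\<bar>of_int q * (of_int P / real b ^ n) - of_int (W (Suc j))\<bar> < 1 / real b ^ A k"
    proof -
      have "\<bar>c - w\<bar> < d + d" if "\<bar>a - c\<bar> \<le> d" "\<bar>a - w\<bar> < d" for a c w d :: real
        using that by linarith
      from this[OF small[unfolded right_diff_distrib] close[OF _ Suc.prems]] show ?thesis by simp
    qed
    then have "\<bar>of_int q * (of_int P / real b ^ n) - of_int (W (Suc j))\<bar> * real b ^ n < 1 / real b ^ A k * real b ^ n"
      using b by (intro mult_strict_right_mono) auto
    moreover have "\<bar>of_int q * (of_int P / real b ^ n) - of_int (W (Suc j))\<bar> * real b ^ n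
        = \<bar>of_int (q * P - W (Suc j) * int b ^ n)\<bar>"
    proof -
      have "\<bar>of_int q * (of_int P / real b ^ n) - of_int (W (Suc j))\<bar> * real b ^ n
        = \<bar>(of_int q * (of_int P / real b ^ n) - of_int (W (Suc j))) * real b ^ n\<bar>"
        by (simp add: abs_mult)
      also have "(of_int q * (of_int P / real b ^ n) - of_int (W (Suc j))) * real b ^ n
        = of_int (q * P - W (Suc j) * int b ^ n)"
        using b by (simp add: field_simps)
      finally show ?thesis .
    qed
    moreover have "1 / real b ^ A k * real b ^ n \<le> real b ^ n0"
      using b power_increasing[OF n, of "real b"] by (simp add: power_add field_simps)
    ultimately have "of_int \<bar>q * P - W (Suc j) * int b ^ n\<bar> < real_of_int (int b ^ n0)"
      by simp
    then have "\<bar>q * P - W (Suc j) * int b ^ n\<bar> < int b ^ n0" by (simp only: of_int_less_iff)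
    moreover have "int b ^ n0 dvd q * P - W (Suc j) * int b ^ n"
      using Suc n_mono unfolding n0_def by (intro dvd_diff dvd_mult2 dvd_mult le_imp_power_dvd) auto
    ultimately have "q * P - W (Suc j) * int b ^ n = 0"
      using dvd_imp_le_int[of "q * P - W (Suc j) * int b ^ n" "int b ^ n0"] b by fastforce
    then have "int b ^ n dvd q * P" by simp
    moreover have "coprime (int b ^ n) P" using P(2) by (simp add: coprime_commute)
    ultimately show ?case unfolding n_def by (simp add: coprime_dvd_mult_left_iff)
  qed
  from this[of m] q show ?thesis using dvd_imp_le_int[of q "int b ^ digit_pos m k"] by fastforce
qed

end

section \<open>Maximum norm and distance to the nearest integer vector\<close>

lemma infnorm_cart_leI:
  fixes x :: "real ^ 'n"
  assumes "\<And>i. \<bar>x $ i\<bar> \<le> a"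
  shows "infnorm x \<le> a"
  unfolding infnorm_cart using assms by (intro cSup_least) auto

lemma dist_int_le: "dist_int x \<le> infnorm (x - int_vec p)"
  unfolding dist_int_def by (rule cINF_lower) (auto intro!: bdd_belowI[of _ 0] simp: infnorm_pos_le)

lemma dist_int_lessD:
  assumes "dist_int x < a"
  obtains p where "infnorm (x - int_vec p) < a"
  using assms unfolding dist_int_def by (subst (asm) cINF_less_iff) (auto intro!: bdd_belowI[of _ 0] simp: infnorm_pos_le)

text \<open>\<open>Sing\<close> and Liouville vectors are defined through |q x - p|, the Dirichlet
  property and \<open>Bad_on\<close> through |x - p/q|; this passes between the two.\<close>

lemma infnorm_scale_rat_vec:
  assumes "q \<ge> 1"
  shows "infnorm (of_int q *\<^sub>R x - int_vec p) = of_int q * infnorm (x - rat_vec p q)"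
proof -
  have "of_int q *\<^sub>R x - int_vec p = of_int q *\<^sub>R (x - rat_vec p q)"
    using assms by (simp add: vec_eq_iff rat_vec_def int_vec_def field_simps)
  then show ?thesis using assms by (simp add: infnorm_mul)
qed

section \<open>The point with lacunary digits in its coordinates\<close>

text \<open>\<open>S\<close> is a common denominator of \<open>X\<close> and \<open>D\<close>.
  \<open>L\<close> is a multiple of m so that an m-th root turns the slack b^L into b^h, and
  \<open>h\<close> is so large that b^h absorbs the constants of the Dirichlet and Liouville
  estimates.\<close>

locale lacunary_point = lacunary b m L A for b m L A +
  fixes X D :: real and S h :: nat and e :: "'n::finite \<Rightarrow> nat" and C :: "real set"
  assumes e: "bij_betw e UNIV {1..m}"
    and S: "S \<ge> 1" and SX: "real S * X \<in> \<int>" and SD: "real S * D \<in> \<int>" and D: "D \<noteq> 0"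
    and Lh: "L = m * h" and h: "8 * \<bar>D\<bar> * real S ^ 2 \<le> real b ^ h" "real S \<le> real b ^ h" "2 * \<bar>D\<bar> \<le> real b ^ h"
    and C: "\<And>T. X + D * digit_sum b T \<in> C"
begin

definition point :: "real ^ 'n" where
  "point = (\<chi> i. X + D * digit_sum b (digits (e i)))"

lemma card_n: "CARD('n) = m"
  using bij_betw_same_card[OF e] by simp

lemma e_bounds: "1 \<le> e i" "e i \<le> m"
  using e by (auto simp: bij_betw_def)

text \<open>Cutting all coordinates at the same \<open>t\<close> gives the common denominator S *
  b^t, and the truncations stay in \<open>C\<close> because every digit set yields a point of
  \<open>C\<close>.\<close>

lemma approximant:
  assumes gap: "\<And>i. 1 \<le> i \<Longrightarrow> i \<le> m \<Longrightarrow> digits i \<inter> {t<..<t'} = {}"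
  obtains p where "rat_vec p (int (S * b ^ t)) \<in> cart_power C"
    "infnorm (point - rat_vec p (int (S * b ^ t))) \<le> 2 * \<bar>D\<bar> / real b ^ t'"
proof -
  have b2: "b \<ge> 2" using b by simp
  let ?v = "\<lambda>i. X + D * digit_sum b (digits (e i) \<inter> {..t})"
  have "\<exists>z :: int. real (S * b ^ t) * ?v i = of_int z" for i
  proof -
    obtain P where P: "digit_sum b (digits (e i) \<inter> {..t}) = of_int P / real b ^ t"
      using digit_sum_integral[OF b2, of "digits (e i) \<inter> {..t}" t] by auto
    have "real (S * b ^ t) * ?v i = real S * X * real b ^ t + real S * D * of_int P"
      unfolding P using b by (simp add: field_simps)
    also have "\<dots> \<in> \<int>" by (intro Ints_add Ints_mult[OF SX] Ints_mult[OF SD]) auto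
    finally show ?thesis by (auto elim: Ints_cases)
  qed
  then obtain z where z: "\<And>i. real (S * b ^ t) * ?v i = of_int (z i)" by metis
  define p where "p = (\<chi> i. z i)"
  have p: "rat_vec p (int (S * b ^ t)) $ i = ?v i" for i
  proof -
    have "real (S * b ^ t) \<noteq> 0" using S b by auto
    then have "?v i = of_int (z i) / real (S * b ^ t)" using z[of i] by (simp add: eq_divide_eq mult.commute)
    then show ?thesis by (simp add: rat_vec_def p_def)
  qed
  have "rat_vec p (int (S * b ^ t)) \<in> cart_power C"
    unfolding cart_power_def mem_Collect_eq p using C by blast
  moreover have "infnorm (point - rat_vec p (int (S * b ^ t))) \<le> 2 * \<bar>D\<bar> / real b ^ t'"
  proof (rule infnorm_cart_leI)
    fix i
    have "(point - rat_vec p (int (S * b ^ t))) $ i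
      = D * (digit_sum b (digits (e i)) - digit_sum b (digits (e i) \<inter> {..t}))"
      unfolding vector_minus_component p by (simp add: point_def right_diff_distrib)
    also have "\<bar>\<dots>\<bar> \<le> \<bar>D\<bar> * (2 / real b ^ t')"
      unfolding abs_mult using digit_sum_gap[OF b2 gap[OF e_bounds]] by (intro mult_left_mono) auto
    also have "\<bar>D\<bar> * (2 / real b ^ t') = 2 * \<bar>D\<bar> / real b ^ t'" by simp
    finally show "\<bar>(point - rat_vec p (int (S * b ^ t))) $ i\<bar> \<le> 2 * \<bar>D\<bar> / real b ^ t'" .
  qed
  ultimately show ?thesis using that by blast
qed

text \<open>One truncation serves all Q below S * b^t'. Dividing the gap ratio by m gives t + h +
  t'/m <= t', so beside the factor b^(t'/m) coming from Q^(1/m) there is still b^h left for the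
  constants.\<close>

lemma gap_bound:
  assumes t: "m * t + L \<le> (m - 1) * t'" and Q: "0 < Q" "Q < real S * real b ^ t'"
  shows "2 * \<bar>D\<bar> / real b ^ t' < 1 / 2 * Q powr (- 1 / real m) / (real S * real b ^ t)"
proof -
  have b0: "real b > 0" using b by simp
  have m0: "real m > 0" using m by simp
  define y where "y = Q powr (1 / real m)"
  have y0: "y > 0" using Q by (simp add: y_def)
  have "y \<le> (real S * real b ^ t') powr (1 / real m)"
    unfolding y_def using Q by (intro powr_mono2) auto
  also have "\<dots> = real S powr (1 / real m) * real b powr (real t' / real m)"
    using b0 by (simp add: powr_mult powr_powr flip: powr_realpow)
  \<comment> \<open>This crude bound brings in the second factor S of the S^2 in the condition on
    \<open>h\<close>; the first is in the denominator S * b^t.\<close>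
  also have "real S powr (1 / real m) \<le> real S powr 1"
    using S m by (intro powr_mono) auto
  finally have y: "y \<le> real S * real b powr (real t' / real m)"
    using S by (simp add: mult_right_mono)
  have exps: "real t + real h + real t' / real m \<le> real t'"
  proof -
    have "real (m * t + L) \<le> real ((m - 1) * t')" using t by (simp only: of_nat_le_iff)
    then have "real m * real t + real m * real h \<le> (real m - 1) * real t'"
      using m by (simp add: Lh of_nat_diff)
    then have "real m * (real t + real h + real t' / real m) \<le> real m * real t'"
      using m0 by (simp add: algebra_simps)
    then show ?thesis using m0 by simp
  qed
  have "4 * \<bar>D\<bar> * (real S * real b ^ t) * y
      \<le> 4 * \<bar>D\<bar> * (real S * real b ^ t) * (real S * real b powr (real t' / real m))"
    using y by (intro mult_left_mono) auto
  also have "\<dots> = (8 * \<bar>D\<bar> * real S ^ 2) * (real b ^ t * real b powr (real t' / real m)) / 2"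
    by (simp add: power2_eq_square)
  also have "\<dots> \<le> real b ^ h * (real b ^ t * real b powr (real t' / real m)) / 2"
    by (intro divide_right_mono mult_right_mono h) auto
  also have "\<dots> = real b powr (real t + real h + real t' / real m) / 2"
    using b0 by (simp add: powr_add powr_realpow)
  also have "\<dots> \<le> real b powr (real t') / 2"
    using b exps by (intro divide_right_mono powr_mono) auto
  also have "\<dots> < real b ^ t'" using b0 by (simp add: powr_realpow)
  finally have "4 * \<bar>D\<bar> * (real S * real b ^ t) * y < real b ^ t'" .
  moreover have "Q powr (- 1 / real m) = 1 / y"
    unfolding y_def using powr_minus_divide[of Q "1 / real m"] by simp
  ultimately show ?thesis using y0 b0 S by (simp only:) (simp add: field_simps)
qed

lemma Dirichlet: "intrinsic_dirichlet (cart_power C) point (1 / 2)"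
  unfolding intrinsic_dirichlet_def card_n
\<comment> \<open>Large enough for the exponent \<open>N\<close> below to satisfy A 0 <= N, as
  \<open>gap_exists\<close> requires.\<close>
proof (intro exI[of _ "real S * real b ^ A 0"] allI impI)
  fix Q :: real assume Q: "real S * real b ^ A 0 \<le> Q"
  have S0: "real S > 0" using S by simp
  have b1: "real b > 1" using b by simp
  have "\<exists>n. Q / real S < real b ^ n" using b1 by (rule real_arch_pow)
  then have ex: "\<exists>n. Q < real S * real b ^ n" using S0 by (simp add: field_simps)
  \<comment> \<open>With n = N + 1 this means S * b^N <= Q < S * b^(N+1): a cut at t <= N keeps the
    denominator at most Q, and t' >= N + 1 puts Q in the range of \<open>gap_bound\<close>.\<close>
  define n where "n = (LEAST n. Q < real S * real b ^ n)"
  have n: "Q < real S * real b ^ n" unfolding n_def using ex by (rule LeastI_ex)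
  with Q have "real S * real b ^ A 0 < real S * real b ^ n" by linarith
  then have "A 0 < n" using S0 b1 by simp
  then obtain N where N: "n = Suc N" by (cases n) auto
  have NQ: "real S * real b ^ N \<le> Q"
    using not_less_Least[of N "\<lambda>n. Q < real S * real b ^ n"] N unfolding n_def by simp
  obtain t t' where t: "t \<le> N" "N < t'" "m * t + L \<le> (m - 1) * t'"
    "\<And>i. 1 \<le> i \<Longrightarrow> i \<le> m \<Longrightarrow> digits i \<inter> {t<..<t'} = {}"
    using gap_exists[of N] \<open>A 0 < n\<close> N by auto
  obtain p where p: "rat_vec p (int (S * b ^ t)) \<in> cart_power C"
    "infnorm (point - rat_vec p (int (S * b ^ t))) \<le> 2 * \<bar>D\<bar> / real b ^ t'"
    using approximant[OF t(4)] by blast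
  have "real b ^ n \<le> real b ^ t'" using t N b1 by (intro power_increasing) auto
  then have "real S * real b ^ n \<le> real S * real b ^ t'" using S0 by simp
  with n have "Q < real S * real b ^ t'" by linarith
  moreover have "0 < Q" using Q S0 b1 by (smt (verit) mult_pos_pos zero_less_power)
  ultimately have "2 * \<bar>D\<bar> / real b ^ t' < 1 / 2 * Q powr (- 1 / real m) / (real S * real b ^ t)"
    using gap_bound[OF t(3)] by blast
  with p have "infnorm (point - rat_vec p (int (S * b ^ t)))
      < 1 / 2 * Q powr (- 1 / real m) / of_int (int (S * b ^ t))" by simp
  moreover have "1 \<le> int (S * b ^ t)"
  proof -
    have "S * b ^ t > 0" using S b by simp
    then show ?thesis by linarith
  qed
  moreover have "of_int (int (S * b ^ t)) \<le> Q"
  proof -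
    have "real b ^ t \<le> real b ^ N" using t b1 by (intro power_increasing) auto
    then have "real S * real b ^ t \<le> real S * real b ^ N" using S0 by simp
    with NQ show ?thesis by simp
  qed
  ultimately show "\<exists>q p. 1 \<le> q \<and> real_of_int q \<le> Q \<and> rat_vec p q \<in> cart_power C \<and>
      infnorm (point - rat_vec p q) < 1 / 2 * Q powr (- 1 / real m) / real_of_int q"
    using p by blast
qed

text \<open>The cut is made behind the last digit of a block \<open>k\<close>, where the gap up to A
  (k + 1) is longer than the denominator's exponent by a factor growing with
  \<open>k\<close>.\<close>

lemma Liouville_approximation:
  "\<exists>(q::int) (p :: int ^ 'n). 2 \<le> q \<and> rat_vec p q \<in> cart_power C \<and>
     infnorm (of_int q *\<^sub>R point - int_vec p) \<le> of_int q powr (- real t)"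
proof -
  \<comment> \<open>The power q^(t+1) costs m * (t + 1) * A k in the exponent of b; two more A k
    cover the shift \<open>L\<close> and the factor 2 |D| <= b^h, since h <= L < A k.\<close>
  define k where "k = m * (t + 1) + 2"
  define q where "q = S * b ^ digit_pos m k"
  have b1: "real b > 1" using b by simp
  have gap: "digits i \<inter> {digit_pos m k<..<digit_pos 1 (Suc k)} = {}" if "1 \<le> i" "i \<le> m" for i
    using no_digit_between[of m i k] that m by simp
  obtain p where p: "rat_vec p (int q) \<in> cart_power C"
    "infnorm (point - rat_vec p (int q)) \<le> 2 * \<bar>D\<bar> / real b ^ digit_pos 1 (Suc k)"
    using approximant[OF gap] unfolding q_def by blast
  have LA: "L < A k" "h \<le> L" using L Lh m by auto
  have "1 * A k \<le> m * A k" using m by (intro mult_right_mono) auto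
  then have LmA: "L < m * A k" using LA by linarith
  \<comment> \<open>\<open>intrinsic_liouville\<close> demands q >= 2; a positive digit position
    supplies a factor b >= 4.\<close>
  have "4 * 1 \<le> b ^ digit_pos m k * S"
  proof (rule mult_mono)
    have "b ^ 1 \<le> b ^ digit_pos m k" using b LmA by (intro power_increasing) (auto simp: digit_pos_def)
    then show "4 \<le> b ^ digit_pos m k" using b by simp
  qed (use S in auto)
  then have q4: "4 \<le> q" by (simp add: q_def mult.commute)
  \<comment> \<open>The factor S <= b^h is compensated by the shift, because h <= L.\<close>
  have "real q \<le> real b ^ (m * A k)"
  proof -
    have "real q \<le> real b ^ h * real b ^ digit_pos m k"
      unfolding q_def of_nat_mult of_nat_power using h by (intro mult_right_mono) auto
    also have "\<dots> \<le> real b ^ (m * A k)"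
      unfolding power_add[symmetric] using b1 LA LmA by (intro power_increasing) (auto simp: digit_pos_def)
    finally show ?thesis .
  qed
  then have "real q ^ (t + 1) \<le> (real b ^ (m * A k)) ^ (t + 1)" by (intro power_mono) auto
  then have "real q ^ (t + 1) * (2 * \<bar>D\<bar>) \<le> real b ^ (m * A k * (t + 1)) * real b ^ h"
    unfolding power_mult[of "real b" "m * A k" "t + 1"] by (rule mult_mono) (use h in simp_all)
  also have "\<dots> \<le> real b ^ digit_pos 1 (Suc k)"
  proof -
    have "A k * (m * (t + 1) + 2) \<le> (k + 4 * m) * A k"
      unfolding k_def by (subst mult.commute) (intro mult_right_mono; simp)
    also have "\<dots> \<le> A (Suc k)" by (rule growth)
    finally have "m * A k * (t + 1) + 2 * A k \<le> A (Suc k)" by (simp add: algebra_simps)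
    then have "m * A k * (t + 1) + h \<le> digit_pos 1 (Suc k)"
      using LA unfolding digit_pos_def by linarith
    then show ?thesis unfolding power_add[symmetric] using b1 by (intro power_increasing) auto
  qed
  finally have main: "real q ^ t * real q * (2 * \<bar>D\<bar>) \<le> real b ^ digit_pos 1 (Suc k)"
    by (simp add: mult.commute)
  have "infnorm (of_int (int q) *\<^sub>R point - int_vec p) \<le> real q * (2 * \<bar>D\<bar> / real b ^ digit_pos 1 (Suc k))"
    using infnorm_scale_rat_vec[of "int q" point p] p q4 by (simp add: mult_left_mono del: times_divide_eq_right)
  also have "\<dots> \<le> 1 / real q ^ t"
    using main q4 b1 by (simp add: field_simps)
  also have "\<dots> = of_int (int q) powr (- real t)"
    using q4 by (simp add: powr_minus_divide powr_realpow)
  finally show ?thesis using p q4 by (intro exI[of _ "int q"] exI[of _ p]) auto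
qed

text \<open>For suitable Q slightly below b^(digit_pos m k), a good denominator q <= Q becomes,
  after clearing the denominators of \<open>X\<close> and \<open>D\<close>, a multiplier q * u that
  \<open>no_small_multiplier\<close> forces to be 0.\<close>

lemma not_singular: "point \<notin> Sing"
proof
  assume "point \<in> Sing"
  obtain u where u: "real S * D = of_int u" using SD by (auto elim: Ints_cases)
  have u0: "u \<noteq> 0" using u S D by auto
  define v where "v = real_of_int \<bar>u\<bar>"
  have v1: "v \<ge> 1" unfolding v_def using u0 by linarith
  obtain x where x: "real S * X = of_int x" using SX by (auto elim: Ints_cases)
  have S1: "real S \<ge> 1" and b1: "real b > 1" using S b by auto
  have m0: "real m > 0" using m by simp
  \<comment> \<open>Chosen to make c * Q^(-1/m) at most 1/(2 * S * b^(A k)) for the Q below; the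
    factor S is lost again when denominators are cleared.\<close>
  define c where "c = 1 / (4 * v * real S * real b ^ h)"
  have "c > 0" unfolding c_def using v1 S1 b1 by simp
  with \<open>point \<in> Sing\<close> obtain Q0 where Q0: "\<And>Q. Q \<ge> Q0 \<Longrightarrow> \<exists>q::int. 1 \<le> q \<and> of_int q \<le> Q \<and>
     dist_int (of_int q *\<^sub>R point) < c * Q powr (- 1 / real m)"
    unfolding Sing_def card_n by blast
  obtain k where k: "2 * v * Q0 < real b ^ k" using real_arch_pow[OF b1] by blast
  \<comment> \<open>The divisor 2 * v keeps |q * u| below b^(digit_pos m k). As digit_pos m k = m *
    (A k - h), Q^(-1/m) is b^(h - A k) up to the factor (2 * v)^(1/m).\<close>
  define Q where "Q = real b ^ digit_pos m k / (2 * v)"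
  have two: "A k + A k \<le> m * A k" using m by (metis mult_2 mult_le_mono1)
  then have "k \<le> digit_pos m k" using L[of k] le_A[of k] by (simp add: digit_pos_def)
  then have "real b ^ k \<le> real b ^ digit_pos m k" using b1 by (intro power_increasing) auto
  then have "Q0 \<le> Q" using k v1 unfolding Q_def by (simp add: field_simps)
  then obtain q :: int where q: "1 \<le> q" "of_int q \<le> Q" "dist_int (of_int q *\<^sub>R point) < c * Q powr (- 1 / real m)"
    using Q0 by blast
  obtain p where p: "infnorm (of_int q *\<^sub>R point - int_vec p) < c * Q powr (- 1 / real m)"
    using dist_int_lessD[OF q(3)] by blast
  have "c * Q powr (- 1 / real m) \<le> 1 / (2 * real S * real b ^ A k)"
  proof -
    have exponent: "real (digit_pos m k) * (- 1 / real m) = real h - real (A k)"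
    proof -
      have "L \<le> m * A k" using two L[of k] by simp
      then have "real (digit_pos m k) = real m * (real (A k) - real h)"
        unfolding digit_pos_def by (simp add: of_nat_diff Lh algebra_simps)
      then show ?thesis using m0 by simp
    qed
    have "Q powr (- 1 / real m) = (2 * v) powr (1 / real m) * real b powr (real h - real (A k))"
    proof -
      have "Q = real b powr real (digit_pos m k) * (2 * v) powr (- 1)"
        unfolding Q_def using b1 v1 by (simp add: powr_realpow powr_minus_divide)
      then have "Q powr (- 1 / real m) = real b powr (real (digit_pos m k) * (- 1 / real m)) * (2 * v) powr (1 / real m)"
        using b1 v1 by (simp only: powr_mult powr_powr) simp
      then show ?thesis unfolding exponent by simp
    qed
    also have "\<dots> \<le> (2 * v) powr 1 * real b powr (real h - real (A k))"
      using v1 m by (intro mult_right_mono powr_mono) auto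
    also have "\<dots> = 2 * v * real b ^ h / real b ^ A k"
      using v1 b1 by (simp add: powr_diff powr_realpow)
    finally have "c * Q powr (- 1 / real m) \<le> c * (2 * v * real b ^ h / real b ^ A k)"
      using \<open>c > 0\<close> by (intro mult_left_mono) auto
    also have "\<dots> = 1 / (2 * real S * real b ^ A k)"
      unfolding c_def using v1 S1 b1 by (simp add: field_simps)
    finally show ?thesis .
  qed
  with p have small: "infnorm (of_int q *\<^sub>R point - int_vec p) < 1 / (2 * real S * real b ^ A k)" by linarith
  \<comment> \<open>From S * (q * point_i - p_i) = q * u * digit_sum - W, where e i = j.\<close>
  define W where "W j = int S * p $ (inv e j) - q * x" for j
  have "\<bar>of_int (q * u) * digit_sum b (digits j) - of_int (W j)\<bar> < 1 / (2 * real b ^ A k)"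
    if "1 \<le> j" "j \<le> m" for j
  proof -
    define i where "i = inv e j"
    have ei: "e i = j" unfolding i_def using e that by (intro f_inv_into_f) (auto simp: bij_betw_def)
    have "\<bar>of_int q * point $ i - of_int (p $ i)\<bar> \<le> infnorm (of_int q *\<^sub>R point - int_vec p)"
      using component_le_infnorm_cart[of "of_int q *\<^sub>R point - int_vec p" i] by (simp add: int_vec_def)
    with small have "real S * \<bar>of_int q * point $ i - of_int (p $ i)\<bar> < real S * (1 / (2 * real S * real b ^ A k))"
      using S1 by (intro mult_strict_left_mono) auto
    also have "\<dots> = 1 / (2 * real b ^ A k)" using S1 by simp
    also have "real S * \<bar>of_int q * point $ i - of_int (p $ i)\<bar> = \<bar>real S * (of_int q * point $ i - of_int (p $ i))\<bar>"
      by (simp add: abs_mult)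
    also have "real S * (of_int q * point $ i - of_int (p $ i))
       = of_int q * (real S * D) * digit_sum b (digits j) - (real S * of_int (p $ i) - of_int q * (real S * X))"
      unfolding point_def by (simp add: ei algebra_simps)
    also have "\<dots> = of_int (q * u) * digit_sum b (digits j) - of_int (W j)"
      unfolding u x W_def i_def by simp
    finally show ?thesis .
  qed
  moreover have "\<bar>q * u\<bar> < int b ^ digit_pos m k"
  proof -
    have "real_of_int \<bar>q * u\<bar> = of_int q * v" using q by (simp add: v_def abs_mult)
    also have "\<dots> \<le> Q * v" using q v1 by (intro mult_right_mono) auto
    also have "\<dots> < real b ^ digit_pos m k" using v1 b1 by (simp add: Q_def)
    finally have "real_of_int \<bar>q * u\<bar> < real_of_int (int b ^ digit_pos m k)" by simp
    then show ?thesis by (simp only: of_int_less_iff)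
  qed
  ultimately have "q * u = 0" by (rule no_small_multiplier[rotated])
  with q u0 show False by simp
qed

lemma Di_minus_Sing: "point \<in> Di_on (cart_power C) - Sing"
proof -
  have "0 < (1 / 2 :: real) \<and> (1 / 2 :: real) < 1" by simp
  then have "point \<in> Di_on (cart_power C)" unfolding Di_on_def using Dirichlet by blast
  then show ?thesis using not_singular by blast
qed

end

section \<open>Relations between singular, badly approximable and Liouville vectors\<close>

text \<open>Its contrapositive yields the irrationality demanded of Liouville vectors.\<close>

lemma rational_imp_Sing:
  fixes \<xi> :: "real ^ 'n"
  assumes "\<And>i. \<xi> $ i \<in> \<rat>"
  shows "\<xi> \<in> Sing"
proof -
  have "\<exists>n > (0::int). of_int n * \<xi> $ i \<in> \<int>" for i
  proof -
    obtain a n where "n > 0" "\<xi> $ i = of_int a / of_int n" using assms[of i] by (rule Rats_cases')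
    then show ?thesis by (intro exI[of _ n]) auto
  qed
  then obtain n :: "'n \<Rightarrow> int" where n: "\<And>i. n i > 0" "\<And>i. of_int (n i) * \<xi> $ i \<in> \<int>" by metis
  define q where "q = (\<Prod>i\<in>UNIV. n i)"
  have "q > 0" unfolding q_def using n by (intro prod_pos) auto
  have "of_int q * \<xi> $ i \<in> \<int>" for i
  proof -
    have "q = (\<Prod>j\<in>UNIV - {i}. n j) * n i" unfolding q_def by (subst prod.remove[of _ i]) auto
    then have "of_int q * \<xi> $ i = of_int (\<Prod>j\<in>UNIV - {i}. n j) * (of_int (n i) * \<xi> $ i)" by simp
    also have "\<dots> \<in> \<int>" by (intro Ints_mult[OF _ n(2)]) auto
    finally show ?thesis .
  qed
  then have "\<exists>z. of_int q * \<xi> $ i = of_int z" for i by (meson Ints_cases)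
  then obtain z where z: "\<And>i. of_int q * \<xi> $ i = of_int (z i)" by metis
  have "dist_int (of_int q *\<^sub>R \<xi>) \<le> infnorm (of_int q *\<^sub>R \<xi> - int_vec (\<chi> i. z i))"
    by (rule dist_int_le)
  also have "of_int q *\<^sub>R \<xi> - int_vec (\<chi> i. z i) = 0"
    by (simp add: vec_eq_iff z int_vec_def)
  finally have d: "dist_int (of_int q *\<^sub>R \<xi>) \<le> 0" by (simp add: infnorm_0)
  show ?thesis unfolding Sing_def
  proof (intro CollectI allI impI exI[of _ "real_of_int q"] exI[of _ q] conjI)
    fix c Q :: real assume c: "c > 0" and Q: "of_int q \<le> Q"
    have "real_of_int q > 0" using \<open>q > 0\<close> by simp
    with Q have "Q > 0" by linarith
    then show "dist_int (of_int q *\<^sub>R \<xi>) < c * Q powr (- 1 / real CARD('n))"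
      using d c by (intro le_less_trans[OF d]) auto
  qed (use \<open>q > 0\<close> in auto)
qed

text \<open>An intrinsic approximation, multiplied by its denominator, is an ordinary one. Hence
  \<open>FS_on K\<close> is contained in \<open>FS_star_on K\<close>.\<close>

lemma Sing_on_subset_Sing: "Sing_on K \<subseteq> (Sing :: (real ^ 'n) set)"
proof
  fix \<xi> :: "real ^ 'n" assume \<xi>: "\<xi> \<in> Sing_on K"
  show "\<xi> \<in> Sing" unfolding Sing_def
  proof (intro CollectI allI impI)
    fix c :: real assume "c > 0"
    with \<xi> obtain Q0 where Q0: "\<And>Q. Q \<ge> Q0 \<Longrightarrow> \<exists>(q::int) (p::int ^ 'n). 1 \<le> q \<and> of_int q \<le> Q \<and> rat_vec p q \<in> K \<and>
        infnorm (\<xi> - rat_vec p q) < c * Q powr (- 1 / real CARD('n)) / of_int q"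
      unfolding Sing_on_def intrinsic_dirichlet_def by blast
    have "\<exists>q::int. 1 \<le> q \<and> of_int q \<le> Q \<and> dist_int (of_int q *\<^sub>R \<xi>) < c * Q powr (- 1 / real CARD('n))"
      if Q: "Q \<ge> Q0" for Q
    proof -
      obtain q and p :: "int ^ 'n" where q: "1 \<le> q" "of_int q \<le> Q"
        "infnorm (\<xi> - rat_vec p q) < c * Q powr (- 1 / real CARD('n)) / of_int q"
        using Q0[OF Q] by blast
      have "dist_int (of_int q *\<^sub>R \<xi>) \<le> of_int q * infnorm (\<xi> - rat_vec p q)"
        using dist_int_le[of "of_int q *\<^sub>R \<xi>" p] infnorm_scale_rat_vec[OF q(1), of \<xi> p] by simp
      also have "\<dots> < of_int q * (c * Q powr (- 1 / real CARD('n)) / of_int q)"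
        using q by (intro mult_strict_left_mono) auto
      also have "\<dots> = c * Q powr (- 1 / real CARD('n))" using q by simp
      finally show ?thesis using q by blast
    qed
    then show "\<exists>Q0. \<forall>Q\<ge>Q0. \<exists>q::int. 1 \<le> q \<and> of_int q \<le> Q \<and>
      dist_int (of_int q *\<^sub>R \<xi>) < c * Q powr (- 1 / real CARD('n))" by blast
  qed
qed

text \<open>Bad approximability would give |q x - p| >= \<kappa> q^(-1/m) >= \<kappa>/q, whereas a
  Liouville exponent above n + 1 gives at most q^(-n-1). Since q >= 2, this implies \<kappa> <=
  2^(-n), which fails for large n.\<close>

lemma intrinsic_liouville_not_Bad_on:
  fixes \<xi> :: "real ^ 'n"
  assumes "intrinsic_liouville K \<xi>"
  shows "\<xi> \<notin> Bad_on K"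
proof
  assume "\<xi> \<in> Bad_on K"
  then obtain \<kappa> where \<kappa>: "\<kappa> > 0" "\<And>(q::int) (p::int ^ 'n). 1 \<le> q \<Longrightarrow> rat_vec p q \<in> K \<Longrightarrow>
     infnorm (rat_vec p q - \<xi>) \<ge> \<kappa> * of_int q powr (- 1 - 1 / real CARD('n))"
    unfolding Bad_on_def by blast
  obtain n where n: "1 / \<kappa> < 2 ^ n" using real_arch_pow[of 2 "1 / \<kappa>"] by auto
  obtain t and q :: int and p :: "int ^ 'n" where t: "t > real n + 1" and q: "2 \<le> q" "rat_vec p q \<in> K"
    "infnorm (of_int q *\<^sub>R \<xi> - int_vec p) \<le> of_int q powr (- t)"
  proof -
    have "real n + 1 > 0" by simp
    then show ?thesis using assms that unfolding intrinsic_liouville_def by blast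
  qed
  let ?r = "real_of_int q"
  have r: "?r \<ge> 2" using q by simp
  have card: "real CARD('n) \<ge> 1" using zero_less_card_finite[where 'a = 'n] by linarith
  have "\<kappa> * ?r powr (- 1) \<le> \<kappa> * ?r powr (- (1 / real CARD('n)))"
    using r card \<kappa> by (intro mult_left_mono powr_mono) auto
  also have "\<dots> = ?r * (\<kappa> * ?r powr (- 1 - 1 / real CARD('n)))"
    using r by (simp add: powr_diff powr_minus_divide)
  also have "\<dots> \<le> ?r * infnorm (rat_vec p q - \<xi>)"
    using \<kappa>(2)[OF _ q(2)] q r by (intro mult_left_mono) auto
  also have "\<dots> = infnorm (of_int q *\<^sub>R \<xi> - int_vec p)"
    using infnorm_scale_rat_vec[of q \<xi> p] q by (simp add: infnorm_sub)
  also have "\<dots> \<le> ?r powr (- t)" by (rule q(3))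
  also have "\<dots> \<le> ?r powr (- (real n + 1))" using t r by (intro powr_mono) auto
  also have "\<dots> = ?r powr (- 1) * ?r powr (- real n)"
  proof -
    have "- (real n + 1) = - 1 + - real n" by simp
    then show ?thesis by (simp only: powr_add)
  qed
  finally have "\<kappa> \<le> ?r powr (- real n)" using r by (simp add: divide_le_cancel)
  also have "\<dots> = 1 / ?r ^ n" using r by (simp add: powr_minus_divide powr_realpow)
  also have "\<dots> \<le> 1 / 2 ^ n" using r by (intro divide_left_mono power_mono) auto
  also have "\<dots> < \<kappa>" using n \<kappa>(1) by (simp add: field_simps)
  finally show False by simp
qed

lemma (in lacunary_point) Liouville: "intrinsic_liouville (cart_power C) point"
proof -
  have "\<exists>t>T. \<exists>(q::int) (p :: int ^ 'n). 2 \<le> q \<and> rat_vec p q \<in> cart_power C \<and>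
        infnorm (of_int q *\<^sub>R point - int_vec p) \<le> of_int q powr (- t)" for T
  proof -
    obtain t where "T < real t" using reals_Archimedean2 by blast
    with Liouville_approximation[of t] show ?thesis by blast
  qed
  then show ?thesis unfolding intrinsic_liouville_def
    using rational_imp_Sing[of point] not_singular by blast
qed

section \<open>Uncountably many lacunary sequences\<close>

text \<open>The last bit of the term with index \<open>k\<close> records whether \<open>k\<close>
  lies in \<open>\<sigma>\<close>; the factorial supplies the growth, and \<open>M\<close> moves the
  start far enough out.\<close>

definition choice_seq :: "nat \<Rightarrow> nat set \<Rightarrow> nat \<Rightarrow> nat" where
  "choice_seq M \<sigma> k = 2 * fact (k + M) + of_bool (k \<in> \<sigma>)"

lemma choice_seq_greater: "k + M < choice_seq M \<sigma> k"
proof -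
  have "k + M \<le> fact (k + M)" "(1 :: nat) \<le> fact (k + M)" by (auto simp: fact_ge_self)
  then show ?thesis unfolding choice_seq_def by linarith
qed

lemma choice_seq_growth: "(k + M) * choice_seq M \<sigma> k \<le> choice_seq M \<sigma> (Suc k)"
proof -
  have "(k + M) * choice_seq M \<sigma> k \<le> (k + M) * (2 * fact (k + M) + 1)"
    unfolding choice_seq_def by (intro mult_left_mono) auto
  also have "\<dots> = 2 * (k + M) * fact (k + M) + (k + M)" by (simp add: algebra_simps)
  \<comment> \<open>The bit costs at most k + M, which the additional 2 * fact (k + M) of the next
    factorial covers.\<close>
  also have "\<dots> \<le> 2 * (k + M) * fact (k + M) + 2 * fact (k + M)"
    using fact_ge_self[of "k + M"] by linarith
  also have "\<dots> = 2 * fact (Suc k + M)" by (simp add: algebra_simps)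
  also have "\<dots> \<le> choice_seq M \<sigma> (Suc k)" by (simp add: choice_seq_def)
  finally show ?thesis .
qed

text \<open>Parity reveals the bit and the remaining factorial reveals the index. M >= 1 avoids the
  coincidence of the factorials of 0 and 1.\<close>

lemma choice_seq_range_subset:
  assumes M: "M \<ge> 1" and sub: "range (choice_seq M \<sigma>) \<subseteq> range (choice_seq M \<sigma>')"
  shows "\<sigma> \<subseteq> \<sigma>'"
proof
  fix k assume k: "k \<in> \<sigma>"
  obtain l where l: "choice_seq M \<sigma> k = choice_seq M \<sigma>' l" using sub by blast
  then have eq: "2 * fact (k + M) + 1 = 2 * fact (l + M) + (of_bool (l \<in> \<sigma>') :: nat)"
    using k by (simp add: choice_seq_def)
  then have "l \<in> \<sigma>'" using Suc_double_not_eq_double by (cases "l \<in> \<sigma>'") auto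
  with eq have "(fact (k + M) :: nat) = fact (l + M)" by simp
  then have "k = l"
    using M fact_less_mono[of "k + M" "l + M", where 'a = nat] fact_less_mono[of "l + M" "k + M", where 'a = nat]
    by (cases k l rule: linorder_cases) auto
  with \<open>l \<in> \<sigma>'\<close> show "k \<in> \<sigma>'" by simp
qed

lemma uncountable_UNIV_nat_set: "uncountable (UNIV :: nat set set)"
proof
  assume "countable (UNIV :: nat set set)"
  then have "range (from_nat_into (UNIV :: nat set set)) = UNIV" by (intro range_from_nat_into) auto
  then show False using Cantors_theorem[of "UNIV :: nat set"] by auto
qed

lemma uncountable_Di_Liouville:
  fixes X D :: real and C :: "real set"
  assumes b: "b \<ge> 4" and m: "CARD('n::finite) \<ge> 2" and S: "S \<ge> 1"
    and SX: "real S * X \<in> \<int>" and SD: "real S * D \<in> \<int>" and D: "D \<noteq> 0"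
    and C: "\<And>T. X + D * digit_sum b T \<in> C"
  shows "uncountable {\<xi> :: real ^ 'n. \<xi> \<in> Di_on (cart_power C) - Sing \<and> intrinsic_liouville (cart_power C) \<xi>}"
proof -
  define m where "m = CARD('n)"
  obtain g :: "nat \<Rightarrow> 'n" where "bij_betw g {1..m} UNIV"
    using ex_bij_betw_nat_finite_1[of "UNIV :: 'n set"] unfolding m_def by auto
  then obtain e :: "'n \<Rightarrow> nat" where e: "bij_betw e UNIV {1..m}"
    using bij_betw_inv_into by metis
  have "real b > 1" using b by simp
  then obtain h where h: "8 * \<bar>D\<bar> * real S ^ 2 + real S + 2 * \<bar>D\<bar> < real b ^ h"
    using real_arch_pow by blast
  define L where "L = m * h"
  \<comment> \<open>The summand \<open>L\<close> makes every term exceed \<open>L\<close>, and 4 * m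
    lets \<open>choice_seq_growth\<close> supply the factor k + 4 * m.\<close>
  define M where "M = L + 4 * m"
  have "lacunary_point b m L (choice_seq M \<sigma>) X D S h e C" for \<sigma>
  proof
    show "L < choice_seq M \<sigma> k" for k using choice_seq_greater[of k M \<sigma>] by (simp add: M_def)
    have "(k + 4 * m) * choice_seq M \<sigma> k \<le> (k + M) * choice_seq M \<sigma> k" for k
      by (intro mult_right_mono) (auto simp: M_def)
    then show "(k + 4 * m) * choice_seq M \<sigma> k \<le> choice_seq M \<sigma> (Suc k)" for k
      using choice_seq_growth[of k M \<sigma>] le_trans by blast
    have nonneg: "8 * \<bar>D\<bar> * real S ^ 2 \<ge> 0" by simp
    show "8 * \<bar>D\<bar> * real S ^ 2 \<le> real b ^ h" "real S \<le> real b ^ h" "2 * \<bar>D\<bar> \<le> real b ^ h"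
      using h nonneg by linarith+
  qed (use b m e S SX SD D C in \<open>auto simp: m_def L_def\<close>)
  then interpret P: lacunary_point b m L "choice_seq M \<sigma>" X D S h e C for \<sigma> .
  have "inj P.point"
  proof (rule injI)
    fix \<sigma> \<sigma>' assume eq: "P.point \<sigma> = P.point \<sigma>'"
    \<comment> \<open>A single coordinate already determines \<open>\<sigma>\<close>.\<close>
    fix i0 :: 'n
    define j where "j = e i0"
    have j: "j \<ge> 1" using P.e_bounds by (simp add: j_def)
    have "P.point \<sigma> $ i0 = P.point \<sigma>' $ i0" using eq by simp
    then have "digit_sum b (P.digits \<sigma> j) = digit_sum b (P.digits \<sigma>' j)"
      using D by (simp add: P.point_def j_def)
    then have dig: "P.digits \<sigma> j = P.digits \<sigma>' j"
      using inj_digit_sum[of b] b by (auto dest: injD)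
    \<comment> \<open>The digit set yields the terms of the sequence only as an unordered set, hence
      the comparison of ranges.\<close>
    have range: "range (choice_seq M \<sigma>) = (\<lambda>n. (n + L) div j) ` P.digits \<sigma> j" for \<sigma>
    proof -
      have "(P.digit_pos \<sigma> j k + L) div j = choice_seq M \<sigma> k" for k
      proof -
        have "1 * L \<le> j * choice_seq M \<sigma> k"
          using j P.L[of \<sigma> k] by (intro mult_mono) auto
        then show ?thesis using j unfolding P.digit_pos_def by simp
      qed
      then show ?thesis unfolding P.digits_def by (simp add: image_image)
    qed
    have "M \<ge> 1" using m by (simp add: M_def m_def)
    with dig range choice_seq_range_subset show "\<sigma> = \<sigma>'" by (metis order_antisym order_refl)
  qed
  then have "uncountable (range P.point)"
    using uncountable_UNIV_nat_set countable_image_inj_on by blast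
  moreover have "range P.point \<subseteq> {\<xi>. \<xi> \<in> Di_on (cart_power C) - Sing \<and> intrinsic_liouville (cart_power C) \<xi>}"
    using P.Di_minus_Sing P.Liouville by blast
  ultimately show ?thesis using countable_subset by blast
qed

section \<open>Reduction of the attractor to digit sums\<close>

theorem theorem2:
  fixes b1 b2 s1 s2 r1 r2 :: int
    and f g :: "real \<Rightarrow> real"
    and C :: "real set"
    and K :: "(real ^ 'm) set"
  assumes "b1 \<ge> 2" "b2 \<ge> 2" "s1 \<ge> 1" "s2 \<ge> 1"
    and "gcd r1 s1 = 1" "gcd r2 s2 = 1"
    and "f = (\<lambda>x. 1 / real_of_int b1 * x + real_of_int r1 / real_of_int s1)"
    and "g = (\<lambda>x. 1 / real_of_int b2 * x + real_of_int r2 / real_of_int s2)"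
    and "real_of_int (b1 * r1) / real_of_int ((b1 - 1) * s1)
           \<noteq> real_of_int (b2 * r2) / real_of_int ((b2 - 1) * s2)"
    and "is_attractor f g C"
    and "CARD('m) \<ge> 2"
    and "K = cart_power C"
  shows "uncountable {\<xi> \<in> Di_on K - Sing. intrinsic_liouville K \<xi>}
           \<and> FS_on K \<noteq> {} \<and> FS_star_on K \<noteq> {}"
proof -
  note f = assms(7) and g = assms(8)
  have C: "compact C" "C \<noteq> {}" "C = f ` C \<union> g ` C"
    using assms(10) by (auto simp: is_attractor_def)
  have fC: "f x \<in> C" and gC: "g x \<in> C" if "x \<in> C" for x using C(3) that by auto
  define b where "b = nat (b1 * b2)"
  \<comment> \<open>b1 * b2 * s1 * s2 clears the denominators of both translation parts, and b1 * b2
    - 1 that of the fixed point \<open>X\<close>.\<close>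
  define S where "S = nat (b1 * b2 * s1 * s2 * (b1 * b2 - 1))"
  have pos: "real_of_int b1 \<ge> 2" "real_of_int b2 \<ge> 2" "real_of_int s1 > 0" "real_of_int s2 > 0"
    using assms by auto
  have bb: "2 * 2 \<le> b1 * b2" using assms by (intro mult_mono) auto
  then have b: "b \<ge> 4" "real b = of_int b1 * of_int b2" by (auto simp: b_def)
  have "0 < b1 * b2 * s1 * s2 * (b1 * b2 - 1)"
    using bb assms by (intro mult_pos_pos) auto
  then have S: "S \<ge> 1" "real S = of_int b1 * of_int b2 * of_int s1 * of_int s2 * (real b - 1)"
    unfolding S_def b by (auto simp: b)
  define \<tau>0 where "\<tau>0 = f (g 0)"
  define \<tau>1 where "\<tau>1 = g (f 0)"
  \<comment> \<open>The fixed point of \<open>f\<close> after \<open>g\<close>, reached by the empty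
    digit set.\<close>
  define X where "X = \<tau>0 * (real b / (real b - 1))"
  have 0: "x / real b + \<tau>0 \<in> C" if "x \<in> C" for x
  proof -
    have "x / real b + \<tau>0 = f (g x)" using pos by (simp add: \<tau>0_def f g b field_simps)
    then show ?thesis using fC gC that by simp
  qed
  have 1: "x / real b + \<tau>1 \<in> C" if "x \<in> C" for x
  proof -
    have "x / real b + \<tau>1 = g (f x)" using pos by (simp add: \<tau>1_def f g b field_simps)
    then show ?thesis using fC gC that by simp
  qed
  have XC: "X + (\<tau>1 - \<tau>0) * digit_sum b T \<in> C" for T
    unfolding X_def using C b by (intro digit_sum_in_attractor 0 1) (auto simp: compact_imp_closed)
  have int0: "of_int b1 * of_int b2 * of_int s1 * of_int s2 * \<tau>0
      = real_of_int (b2 * s1 * r2 + b1 * b2 * s2 * r1)"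
    using pos by (simp add: \<tau>0_def f g field_simps)
  have int1: "of_int b1 * of_int b2 * of_int s1 * of_int s2 * \<tau>1
      = real_of_int (b1 * s2 * r1 + b1 * b2 * s1 * r2)"
    using pos by (simp add: \<tau>1_def f g field_simps)
  have "real S * X = of_int b1 * of_int b2 * of_int s1 * of_int s2 * \<tau>0 * real b"
    using b(1) unfolding S(2) X_def by simp
  also have "\<dots> \<in> \<int>" unfolding int0 by (intro Ints_mult) auto
  finally have SX: "real S * X \<in> \<int>" .
  have "real S * (\<tau>1 - \<tau>0) = (of_int b1 * of_int b2 * of_int s1 * of_int s2 * \<tau>1
      - of_int b1 * of_int b2 * of_int s1 * of_int s2 * \<tau>0) * (real b - 1)"
    unfolding S(2) by (simp add: algebra_simps)
  also have "\<dots> \<in> \<int>" unfolding int0 int1 by (intro Ints_mult Ints_diff) auto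
  finally have SD: "real S * (\<tau>1 - \<tau>0) \<in> \<int>" .
  \<comment> \<open>The difference of the translation parts is a nonzero multiple of the difference
    of the fixed points of \<open>g\<close> and \<open>f\<close>, which are distinct by
    assumption.\<close>
  have "\<tau>1 - \<tau>0 = real_of_int ((b1 - 1) * (b2 - 1)) / of_int (b1 * b2) *
      (real_of_int (b2 * r2) / real_of_int ((b2 - 1) * s2) - real_of_int (b1 * r1) / real_of_int ((b1 - 1) * s1))"
  proof -
    have "real_of_int b1 - 1 \<noteq> 0" "real_of_int b2 - 1 \<noteq> 0" using pos by auto
    then show ?thesis using pos by (simp add: \<tau>0_def \<tau>1_def f g divide_simps) (simp add: algebra_simps)
  qed
  moreover have "real_of_int ((b1 - 1) * (b2 - 1)) / of_int (b1 * b2) \<noteq> 0" using assms by auto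
  ultimately have D: "\<tau>1 - \<tau>0 \<noteq> 0" using assms(9) by auto
  have unc: "uncountable {\<xi> \<in> Di_on K - Sing. intrinsic_liouville K \<xi>}"
    unfolding assms(12) using uncountable_Di_Liouville[OF b(1) assms(11) S(1) SX SD D XC] by simp
  then have "{\<xi> \<in> Di_on K - Sing. intrinsic_liouville K \<xi>} \<noteq> {}" by (metis countable_empty)
  then obtain \<xi> where "\<xi> \<in> Di_on K" "\<xi> \<notin> Sing" "\<xi> \<notin> Bad_on K"
    using intrinsic_liouville_not_Bad_on by blast
  then have "\<xi> \<in> FS_on K" "\<xi> \<in> FS_star_on K"
    using Sing_on_subset_Sing unfolding FS_on_def FS_star_on_def by auto
  with unc show ?thesis by blast
qed

end
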